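(* There is an absolute constant $c>0$ such that for every $n\ge 2$ and every total Boolean function $f:\{0,1\}^n\to\{0,1\}$, $$R_0(f)\le c\, RC(f)\,\mathrm{ndeg}(f)\,\log n .$$
   Context: Query model: the input $Y=y_1\ldots y_n\in\{0,1\}^n$ is accessed only through (possibly adaptive) queries to the bits $y_i$; only queries are counted. $R_0(f)$ (zero-error randomized query complexity) is the minimum expected number of queries (worst case over $Y$) of a randomized algorithm that outputs $f(Y)$ with probability $1$ for every $Y$. A randomized verifier for an input $X$ is a randomized query algorithm that, on input $Y$, (i) accepts with probability $1$ if $Y=X$, and (ii) rejects with probability at least $1/2$ if $f(Y)\neq f(X)$ (if $Y\ne X$ but $f(Y)=f(X)$ the acceptance probability can be arbitrary). The algorithm may depend on $X$ and $f$. $RC^X(f)$ is the minimum expected number of queries (worst case over $Y$) used by a randomized verifier for $X$, and $RC(f)=\max_X RC^X(f)$. A real multilinear polynomial $p(x_1,\ldots,x_n)$ nondeterministically represents $f$ if for all $X\in\{0,1\}^n$, $p(X)\ne 0$ if and only if $f(X)\neq 0$. $\mathrm{ndeg}(f)$ is the minimum degree of a polynomial that nondeterministically represents $f$ (constant polynomials, including $0$, have degree $0$). *)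

theory Defs
  imports "HOL-Probability.Probability"
begin

text \<open>
  Inputs are the bit lists of length \<open>n\<close>, with positions \<open>0, \<dots>, n - 1\<close>.  A Boolean function on
  \<open>n\<close> bits is a function \<open>f :: bool list \<Rightarrow> bool\<close>; no definition below depends on its values outside
  \<open>cube n\<close>.
\<close>

definition cube :: "nat \<Rightarrow> bool list set" where
  "cube n = {Y. length Y = n}"

text \<open>
  A deterministic (adaptive) query algorithm is a decision tree.  \<open>Query i t u\<close> queries the bit at
  position \<open>i\<close> and continues with \<open>t\<close> if it is 0 and with \<open>u\<close> if it is 1.
\<close>

datatype dtree = Answer bool | Query nat dtree dtree

primrec result :: "dtree \<Rightarrow> bool list \<Rightarrow> bool" where
  "result (Answer b) Y = b"
| "result (Query i t u) Y = (if Y ! i then result u Y else result t Y)"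

primrec queries :: "dtree \<Rightarrow> bool list \<Rightarrow> nat" where
  "queries (Answer b) Y = 0"
| "queries (Query i t u) Y = Suc (if Y ! i then queries u Y else queries t Y)"

primrec valid_dtree :: "nat \<Rightarrow> dtree \<Rightarrow> bool" where
  "valid_dtree n (Answer b) \<longleftrightarrow> True"
| "valid_dtree n (Query i t u) \<longleftrightarrow> i < n \<and> valid_dtree n t \<and> valid_dtree n u"

text \<open>
  A randomized query algorithm is a probability distribution on decision trees.  As there are only
  countably many trees, every such distribution is given by a probability mass function.
\<close>

definition randomized_algorithm :: "nat \<Rightarrow> dtree pmf \<Rightarrow> bool" where
  "randomized_algorithm n A \<longleftrightarrow> (\<forall>t\<in>set_pmf A. valid_dtree n t)"

definition expected_queries :: "dtree pmf \<Rightarrow> bool list \<Rightarrow> ennreal" where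
  "expected_queries A Y = (\<integral>\<^sup>+ t. of_nat (queries t Y) \<partial>measure_pmf A)"

definition worst_case_queries :: "nat \<Rightarrow> dtree pmf \<Rightarrow> ennreal" where
  "worst_case_queries n A = (SUP Y\<in>cube n. expected_queries A Y)"

definition zero_error :: "nat \<Rightarrow> (bool list \<Rightarrow> bool) \<Rightarrow> dtree pmf \<Rightarrow> bool" where
  "zero_error n f A \<longleftrightarrow> randomized_algorithm n A \<and>
     (\<forall>Y\<in>cube n. measure_pmf.prob A {t. result t Y = f Y} = 1)"

text \<open>
  The infima defining \<open>R0\<close> and \<open>RC_at\<close> are minima: never querying a position twice does not increase
  the cost, which leaves finitely many trees and hence a compact set of distributions.
\<close>

definition R0 :: "nat \<Rightarrow> (bool list \<Rightarrow> bool) \<Rightarrow> ennreal" where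
  "R0 n f = (INF A\<in>{A. zero_error n f A}. worst_case_queries n A)"

text \<open>Accepting means answering \<open>True\<close>.\<close>

definition verifier :: "nat \<Rightarrow> (bool list \<Rightarrow> bool) \<Rightarrow> bool list \<Rightarrow> dtree pmf \<Rightarrow> bool" where
  "verifier n f X V \<longleftrightarrow> randomized_algorithm n V \<and>
     measure_pmf.prob V {t. result t X} = 1 \<and>
     (\<forall>Y\<in>cube n. f Y \<noteq> f X \<longrightarrow> measure_pmf.prob V {t. \<not> result t Y} \<ge> 1 / 2)"

definition RC_at :: "nat \<Rightarrow> (bool list \<Rightarrow> bool) \<Rightarrow> bool list \<Rightarrow> ennreal" where
  "RC_at n f X = (INF V\<in>{V. verifier n f X V}. worst_case_queries n V)"

definition RC :: "nat \<Rightarrow> (bool list \<Rightarrow> bool) \<Rightarrow> ennreal" where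
  "RC n f = (SUP X\<in>cube n. RC_at n f X)"

text \<open>
  A real multilinear polynomial in \<open>x\<^sub>0, \<dots>, x\<^sub>n\<^sub>-\<^sub>1\<close> is given by its coefficients: \<open>p S\<close> is the
  coefficient of the monomial \<open>\<Prod>i\<in>S. x\<^sub>i\<close>, and is nonzero only for \<open>S \<subseteq> {..<n}\<close>.
\<close>

definition multilinear_polys :: "nat \<Rightarrow> (nat set \<Rightarrow> real) set" where
  "multilinear_polys n = {p. \<forall>S. p S \<noteq> 0 \<longrightarrow> S \<subseteq> {..<n}}"

definition poly_value :: "nat \<Rightarrow> (nat set \<Rightarrow> real) \<Rightarrow> (nat \<Rightarrow> real) \<Rightarrow> real" where
  "poly_value n p x = (\<Sum>S\<in>Pow {..<n}. p S * (\<Prod>i\<in>S. x i))"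

text \<open>The inserted 0 makes the zero polynomial have degree 0.\<close>

definition poly_degree :: "(nat set \<Rightarrow> real) \<Rightarrow> nat" where
  "poly_degree p = Max (insert 0 (card ` {S. p S \<noteq> 0}))"

definition nondet_represents :: "nat \<Rightarrow> (nat set \<Rightarrow> real) \<Rightarrow> (bool list \<Rightarrow> bool) \<Rightarrow> bool" where
  "nondet_represents n p f \<longleftrightarrow>
     (\<forall>X\<in>cube n. poly_value n p (\<lambda>i. of_bool (X ! i)) \<noteq> 0 \<longleftrightarrow> f X)"

definition ndeg :: "nat \<Rightarrow> (bool list \<Rightarrow> bool) \<Rightarrow> nat" where
  "ndeg n f = (LEAST d. \<exists>p\<in>multilinear_polys n. nondet_represents n p f \<and> poly_degree p = d)"

end

theory Submission
  imports Defs
begin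

text \<open>
  Let \<open>p\<close> of degree \<open>d = ndeg f\<close> nondeterministically represent \<open>f\<close>.  Restrict \<open>p\<close> to the subcube of
  inputs consistent with the answers so far, and let \<open>X\<close> be a 0-input in this subcube.  Every maximal
  monomial of the restricted polynomial contains a block whose flip turns \<open>X\<close> into a 1-input, so the
  positions that a verifier for \<open>X\<close> reads on \<open>X\<close> meet each maximal monomial with probability at least
  1/2.  Querying these positions costs about \<open>RC f\<close> and lowers the degree of each monomial that is met.
  With weight \<open>k!\<close> for a monomial of degree \<open>k > 0\<close> and 0 for the constant one, the monomials
  contained in a maximal one weigh at most three times as much as it does, so a round
  reduces the expected total weight by a constant factor.  Initially it is at most \<open>n ^ (d + 1)\<close>; hence
  after \<open>O(d log n)\<close> rounds the polynomial is constant except with probability at most \<open>1 / n\<close>, and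
  then the algorithm can afford to query everything.
\<close>

subsection \<open>Multilinear polynomials\<close>

abbreviation bits :: "bool list \<Rightarrow> nat \<Rightarrow> real" where
  "bits Y \<equiv> \<lambda>i. of_bool (Y ! i)"

definition supp :: "(nat set \<Rightarrow> real) \<Rightarrow> nat set set" where
  "supp p = {S. p S \<noteq> 0}"

text \<open>\<open>p\<close> is \<open>var_free i p\<close> plus the variable \<open>i\<close> times
  \<open>var_coeff i p\<close>. Both are 0 on sets containing \<open>i\<close>, so neither part
  depends on that variable.\<close>

definition var_free :: "nat \<Rightarrow> (nat set \<Rightarrow> real) \<Rightarrow> nat set \<Rightarrow> real" where
  "var_free i p S = (if i \<in> S then 0 else p S)"

definition var_coeff :: "nat \<Rightarrow> (nat set \<Rightarrow> real) \<Rightarrow> nat set \<Rightarrow> real" where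
  "var_coeff i p S = (if i \<in> S then 0 else p (insert i S))"

definition fix_var :: "nat \<Rightarrow> bool \<Rightarrow> (nat set \<Rightarrow> real) \<Rightarrow> nat set \<Rightarrow> real" where
  "fix_var i b p S = var_free i p S + of_bool b * var_coeff i p S"

lemma supp_multilinear: "p \<in> multilinear_polys n \<Longrightarrow> supp p \<subseteq> Pow {..<n}"
  by (auto simp: multilinear_polys_def supp_def)

lemma finite_supp: "p \<in> multilinear_polys n \<Longrightarrow> finite (supp p)"
  using supp_multilinear finite_subset by blast

lemma card_le_poly_degree:
  assumes "p \<in> multilinear_polys n" "S \<in> supp p"
  shows "card S \<le> poly_degree p"
  using finite_supp[OF assms(1)] assms(2) by (simp add: poly_degree_def supp_def)

lemma poly_value_cong:
  assumes "\<And>i. i < n \<Longrightarrow> x i = y i"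
  shows "poly_value n p x = poly_value n p y"
  unfolding poly_value_def using assms
  by (intro sum.cong arg_cong2[where f = "(*)"] prod.cong) auto

lemma poly_value_split:
  assumes "i < n"
  shows "poly_value n p x = poly_value n (var_free i p) x + x i * poly_value n (var_coeff i p) x"
proof -
  let ?A = "{..<n} - {i}"
  have split: "(\<Sum>S\<in>Pow {..<n}. g S) = (\<Sum>S\<in>Pow ?A. g S + g (insert i S))"
    for g :: "nat set \<Rightarrow> real"
  proof -
    have *: "Pow {..<n} = Pow ?A \<union> insert i ` Pow ?A"
      using assms Pow_insert[of i ?A] by (simp add: insert_absorb)
    have inj: "inj_on (insert i) (Pow ?A)"
      by (auto simp: inj_on_def)
    have "(\<Sum>S\<in>Pow {..<n}. g S) = sum g (Pow ?A) + sum g (insert i ` Pow ?A)"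
      unfolding * by (rule sum.union_disjoint) auto
    then show ?thesis
      by (simp add: sum.reindex[OF inj] sum.distrib)
  qed
  have "(\<Prod>j\<in>insert i S. x j) = x i * (\<Prod>j\<in>S. x j)" if "S \<in> Pow ?A" for S
    using that finite_subset[of S "{..<n}"] by (subst prod.insert) auto
  then show ?thesis
    unfolding poly_value_def split sum_distrib_left sum.distrib[symmetric]
    by (intro sum.cong) (auto simp: var_free_def var_coeff_def algebra_simps)
qed

lemma poly_value_var_free_upd: "poly_value n (var_free i p) (x(i := a)) = poly_value n (var_free i p) x"
  unfolding poly_value_def var_free_def
  by (intro sum.cong) (auto intro!: prod.cong)

lemma poly_value_var_coeff_upd: "poly_value n (var_coeff i p) (x(i := a)) = poly_value n (var_coeff i p) x"
  unfolding poly_value_def var_coeff_def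
  by (intro sum.cong) (auto intro!: prod.cong)

lemma poly_value_fix_var:
  assumes "i < n" "x i = of_bool b"
  shows "poly_value n (fix_var i b p) x = poly_value n p x"
  unfolding poly_value_split[OF assms(1), of p] assms(2)
  by (simp add: poly_value_def fix_var_def algebra_simps sum.distrib sum_distrib_left)

text \<open>The new coefficient of \<open>S\<close> combines the old ones of \<open>S\<close> and
  \<open>insert i S\<close>. These may cancel, hence only an inclusion.\<close>

lemma supp_fix_var: "supp (fix_var i b p) \<subseteq> (\<lambda>S. S - {i}) ` supp p"
proof
  fix S assume "S \<in> supp (fix_var i b p)"
  then have "i \<notin> S" "p S \<noteq> 0 \<or> p (insert i S) \<noteq> 0"
    by (auto simp: supp_def fix_var_def var_free_def var_coeff_def split: if_splits)
  then have "S = S - {i}" "S = insert i S - {i}" "S \<in> supp p \<or> insert i S \<in> supp p"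
    by (auto simp: supp_def)
  then show "S \<in> (\<lambda>S. S - {i}) ` supp p"
    by blast
qed

lemma fix_var_multilinear:
  assumes "p \<in> multilinear_polys n"
  shows "fix_var i b p \<in> multilinear_polys n"
proof -
  have "S \<subseteq> {..<n}" if "S \<in> supp (fix_var i b p)" for S
    using that supp_fix_var[of i b p] supp_multilinear[OF assms] by blast
  then show ?thesis
    by (auto simp: multilinear_polys_def supp_def)
qed

lemma poly_value_constant:
  assumes "supp p \<subseteq> {{}}"
  shows "poly_value n p x = p {}"
proof -
  have "poly_value n p x = (\<Sum>S\<in>{{}}. p S * (\<Prod>i\<in>S. x i))"
    unfolding poly_value_def using assms
    by (intro sum.mono_neutral_right) (auto simp: supp_def)
  then show ?thesis
    by simp
qed

text \<open>A point on which a polynomial differs from zero can be reached by changing only the variables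
  of a maximal monomial: otherwise all iterated differences in these variables vanish, and the last
  of them is the coefficient of that monomial.\<close>

lemma maximal_monomial_nonvanishing:
  fixes x :: "nat \<Rightarrow> real"
  assumes "finite M" "M \<subseteq> {..<n}" "p M \<noteq> 0" "\<And>S. M \<subset> S \<Longrightarrow> p S = 0" "\<And>i. x i \<in> {0, 1}"
  shows "\<exists>y. (\<forall>i. y i \<in> {0, 1}) \<and> (\<forall>i. i \<notin> M \<longrightarrow> y i = x i) \<and> poly_value n p y \<noteq> 0"
  using assms
proof (induction M arbitrary: p rule: finite_induct)
  case empty
  then have "supp p \<subseteq> {{}}"
    by (auto simp: supp_def)
  with empty poly_value_constant[of p n x] show ?case
    by (intro exI[of _ x]) auto
next
  case (insert i M)
  have i: "i < n"
    using insert.prems by auto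
  have "var_coeff i p S = 0" if "M \<subset> S" for S
  proof (cases "i \<in> S")
    case False
    then have "insert i M \<subset> insert i S"
      using that insert.hyps by auto
    with insert.prems show ?thesis
      by (simp add: var_coeff_def)
  qed (simp add: var_coeff_def)
  moreover have "var_coeff i p M \<noteq> 0"
    using insert by (simp add: var_coeff_def)
  ultimately obtain y where y: "\<forall>i. y i \<in> {0, 1}" "\<forall>i. i \<notin> M \<longrightarrow> y i = x i"
      "poly_value n (var_coeff i p) y \<noteq> 0"
    using insert.IH[of "var_coeff i p"] insert.prems by auto
  have "poly_value n p (y(i := 1)) - poly_value n p (y(i := 0)) = poly_value n (var_coeff i p) y"
    by (simp add: poly_value_split[OF i, of p] poly_value_var_free_upd poly_value_var_coeff_upd)
  then have "poly_value n p (y(i := 1)) \<noteq> 0 \<or> poly_value n p (y(i := 0)) \<noteq> 0"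
    using y(3) by auto
  then show ?case
  proof
    assume "poly_value n p (y(i := 1)) \<noteq> 0"
    moreover have "\<forall>j. (y(i := 1)) j \<in> {0, 1}" "\<forall>j. j \<notin> insert i M \<longrightarrow> (y(i := 1)) j = x j"
      using y by auto
    ultimately show ?thesis by blast
  next
    assume "poly_value n p (y(i := 0)) \<noteq> 0"
    moreover have "\<forall>j. (y(i := 0)) j \<in> {0, 1}" "\<forall>j. j \<notin> insert i M \<longrightarrow> (y(i := 0)) j = x j"
      using y by auto
    ultimately show ?thesis by blast
  qed
qed

text \<open>Moebius inversion over the sets of ones gives the multilinear polynomial that equals
  \<open>f\<close> on the cube. It ensures that the \<open>LEAST\<close> in \<open>ndeg\<close> is
  attained.\<close>

lemma nondet_represents_exists: "\<exists>p\<in>multilinear_polys n. nondet_represents n p f"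
proof -
  define F :: "nat set \<Rightarrow> real" where "F A = of_bool (f (map (\<lambda>i. i \<in> A) [0..<n]))" for A
  define g where "g A = (\<Sum>B\<in>Pow A. (- 1) ^ card B * F B)" for A
  define p where "p S = (if S \<subseteq> {..<n} then (- 1) ^ card S * g S else 0)" for S
  have inv: "F A = (\<Sum>B\<in>Pow A. (- 1) ^ card B * g B)" if "finite A" for A
    by (rule inclusion_exclusion_symmetric[of g F]) (simp_all only: g_def that)
  have "poly_value n p (bits X) = of_bool (f X)" if X: "X \<in> cube n" for X
  proof -
    let ?A = "{i. i < n \<and> X ! i}"
    have "(\<Prod>i\<in>S. bits X i) = of_bool (S \<subseteq> ?A)" if "S \<subseteq> {..<n}" for S
      using that finite_subset[OF that] by (auto simp: of_bool_def intro!: prod.neutral)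
    then have "poly_value n p (bits X) = (\<Sum>S\<in>Pow {..<n}. if S \<subseteq> ?A then p S else 0)"
      unfolding poly_value_def by (intro sum.cong) auto
    also have "\<dots> = (\<Sum>S\<in>Pow ?A. (- 1) ^ card S * g S)"
      by (intro sum.mono_neutral_cong_right) (auto simp: p_def)
    also have "\<dots> = F ?A"
      by (rule inv[symmetric]) simp
    also have "map (\<lambda>i. i \<in> ?A) [0..<n] = X"
      using X by (auto simp: cube_def intro!: nth_equalityI)
    then have "F ?A = of_bool (f X)"
      unfolding F_def by simp
    finally show ?thesis .
  qed
  moreover have "p \<in> multilinear_polys n"
    by (auto simp: p_def multilinear_polys_def)
  ultimately show ?thesis
    by (auto simp: nondet_represents_def intro!: bexI[of _ p])
qed

lemma ndeg_attained:
  obtains p where "p \<in> multilinear_polys n" "nondet_represents n p f" "poly_degree p = ndeg n f"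
proof -
  have "\<exists>d. \<exists>p\<in>multilinear_polys n. nondet_represents n p f \<and> poly_degree p = d"
    using nondet_represents_exists by blast
  from LeastI_ex[OF this]
  have "\<exists>p\<in>multilinear_polys n. nondet_represents n p f \<and> poly_degree p = ndeg n f"
    by (simp only: ndeg_def)
  then show ?thesis
    using that by blast
qed


subsection \<open>The potential of a family of monomials\<close>

text \<open>The factorial makes the loss of one variable at least halve the weight. From degree 1 to
  0 this relies on the value 0 at \<open>k = 0\<close>, which also gives constant polynomials
  potential 0.\<close>

definition weight :: "nat \<Rightarrow> real" where
  "weight k = (if k = 0 then 0 else fact k)"

definition potential :: "nat set set \<Rightarrow> real" where
  "potential F = (\<Sum>S\<in>F. weight (card S))"

lemma weight_0 [simp]: "weight 0 = 0"
  by (simp add: weight_def)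

lemma weight_nonneg [simp]: "0 \<le> weight k"
  by (simp add: weight_def)

lemma weight_le_fact: "weight k \<le> fact k"
  by (simp add: weight_def)

lemma weight_mono: "k \<le> l \<Longrightarrow> weight k \<le> weight l"
  by (auto simp: weight_def fact_mono)

lemma weight_Suc: "2 * weight k \<le> weight (Suc k)"
proof (cases k)
  case (Suc m)
  have "2 * fact k \<le> (1 + real k) * fact k"
    using Suc by (intro mult_right_mono) auto
  then show ?thesis
    using Suc by (simp add: weight_def)
qed (simp add: weight_def)

lemma weight_card_Diff:
  assumes "finite S"
  shows "weight (card (S - Q)) \<le> weight (card S) - weight (card S) / 2 * of_bool (S \<inter> Q \<noteq> {})"
proof (cases "S \<inter> Q = {}")
  case True
  then have "S - Q = S" by auto
  with True show ?thesis by simp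
next
  case False
  then have "card (S - Q) < card S"
    using assms by (intro psubset_card_mono) auto
  \<comment> \<open>By monotonicity, the removal of a single element is the worst case.\<close>
  then have "weight (card (S - Q)) \<le> weight (card S - 1)" "Suc (card S - 1) = card S"
    by (auto intro: weight_mono)
  with weight_Suc[of "card S - 1"] False show ?thesis
    by simp
qed

lemma potential_nonneg: "0 \<le> potential F"
  by (simp add: potential_def sum_nonneg)

lemma sum_subsets_by_card:
  fixes g :: "nat \<Rightarrow> real"
  assumes "finite A"
  shows "(\<Sum>S | S \<subseteq> A \<and> card S \<le> d. g (card S)) = (\<Sum>k\<le>d. real (card A choose k) * g k)"
proof -
  have "(\<Sum>S | S \<subseteq> A \<and> card S \<le> d. g (card S)) =
      (\<Sum>k\<le>d. \<Sum>S | S \<in> {S. S \<subseteq> A \<and> card S \<le> d} \<and> card S = k. g (card S))"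
    using assms by (intro sum.group[symmetric]) auto
  also have "\<dots> = (\<Sum>k\<le>d. \<Sum>S | S \<subseteq> A \<and> card S = k. g k)"
    by (intro sum.cong) auto
  also have "\<dots> = (\<Sum>k\<le>d. real (card A choose k) * g k)"
    using n_subsets[OF assms] by simp
  finally show ?thesis .
qed

text \<open>The subsets of size \<open>k\<close> of a \<open>d\<close>-set weigh at most d!/(d-k)!
  together. Summing over \<open>k\<close> gives d! times a partial sum of the series for e, and e is
  at most 3.\<close>

lemma potential_Pow_le:
  assumes "finite M"
  shows "potential (Pow M) \<le> 3 * weight (card M)"
proof (cases "M = {}")
  case False
  define d where "d = card M"
  have d: "d \<noteq> 0"
    using False assms by (simp add: d_def)
  have "Pow M = {S. S \<subseteq> M \<and> card S \<le> d}"
    using assms by (auto simp: d_def card_mono)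
  then have "potential (Pow M) = (\<Sum>k\<le>d. real (d choose k) * weight k)"
    unfolding potential_def using sum_subsets_by_card[OF assms, of weight d] by (simp add: d_def)
  also have "\<dots> \<le> (\<Sum>k\<le>d. real (d choose k) * fact k)"
    by (intro sum_mono mult_left_mono weight_le_fact) auto
  also have "\<dots> = (\<Sum>k\<le>d. fact d * inverse (fact (d - k)))"
    by (intro sum.cong) (auto simp: binomial_fact field_simps)
  also have "\<dots> = fact d * (\<Sum>k\<le>d. inverse (fact k))"
    unfolding sum_distrib_left[symmetric]
    by (rule arg_cong[OF sum.reindex_bij_witness[of _ "\<lambda>k. d - k" "\<lambda>k. d - k"]]) auto
  also have "(\<Sum>k\<le>d. inverse (fact k)) \<le> exp (1::real)"
    unfolding exp_def using summable_exp[of "1::real"]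
    by (auto intro!: sum_le_suminf simp: divide_inverse)
  also have "exp (1::real) \<le> 3"
    by (rule exp_le)
  finally show ?thesis
    using d by (simp add: weight_def d_def algebra_simps)
qed (simp add: potential_def)

text \<open>Charge each member to a maximal one containing it. By the bound for power sets a maximal
  member is charged at most three times its weight.\<close>

lemma potential_maximal:
  assumes "finite F" "\<And>S. S \<in> F \<Longrightarrow> finite S"
  shows "potential F \<le> 3 * potential {M \<in> F. \<forall>S\<in>F. \<not> M \<subset> S}"
proof -
  let ?X = "{M \<in> F. \<forall>S\<in>F. \<not> M \<subset> S}"
  have "\<exists>M\<in>?X. S \<subseteq> M" if "S \<in> F" for S
    using finite_has_maximal2[OF assms(1) that] by auto
  then have sub: "F \<subseteq> (\<Union>M\<in>?X. Pow M)"
    by blast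
  have "potential F \<le> (\<Sum>(M, S)\<in>Sigma ?X Pow. weight (card S))"
    unfolding potential_def using assms sub
  proof (intro sum_le_included[where i = snd] ballI)
    show "finite (Sigma ?X Pow)"
      using assms by (intro finite_SigmaI) auto
  next
    fix S assume "S \<in> F"
    with sub obtain M where "M \<in> ?X" "S \<subseteq> M"
      by blast
    then show "\<exists>y\<in>Sigma ?X Pow. snd y = S \<and> weight (card S) \<le> (case y of (M, S) \<Rightarrow> weight (card S))"
      by (intro bexI[of _ "(M, S)"]) auto
  qed (use assms(1) in auto)
  also have "\<dots> = (\<Sum>M\<in>?X. \<Sum>S\<in>Pow M. weight (card S))"
    using assms by (intro sum.Sigma[symmetric]) auto
  also have "\<dots> \<le> (\<Sum>M\<in>?X. 3 * weight (card M))"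
    using potential_Pow_le assms(2) by (intro sum_mono) (auto simp: potential_def)
  finally show ?thesis
    by (simp add: potential_def sum_distrib_left)
qed

text \<open>Different monomials may become equal once \<open>Q\<close> is removed; the left side
  counts them once, the right side separately.\<close>

lemma potential_image_Diff:
  assumes "finite F" "G \<subseteq> (\<lambda>S. S - Q) ` F"
  shows "potential G \<le> (\<Sum>S\<in>F. weight (card (S - Q)))"
proof -
  have "potential G \<le> potential ((\<lambda>S. S - Q) ` F)"
    unfolding potential_def using assms by (intro sum_mono2) auto
  also have "\<dots> \<le> (\<Sum>S\<in>F. weight (card (S - Q)))"
    unfolding potential_def using sum_image_le[OF assms(1), of "\<lambda>S. weight (card S)" "\<lambda>S. S - Q"]
    by (simp add: o_def)
  finally show ?thesis .
qed

text \<open>This permits a Markov-type argument: the potential dominates the indicator that a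
  polynomial is not yet constant.\<close>

lemma potential_ge_1:
  assumes "finite F" "\<And>S. S \<in> F \<Longrightarrow> finite S" "\<not> F \<subseteq> {{}}"
  shows "1 \<le> potential F"
proof -
  from assms(3) obtain S where S: "S \<in> F" "S \<noteq> {}"
    by blast
  then have "1 \<le> weight (card S)"
    using assms(2) by (simp add: weight_def)
  also have "\<dots> \<le> potential F"
    unfolding potential_def using S assms by (intro member_le_sum) auto
  finally show ?thesis .
qed

text \<open>The monomials of degree \<open>k\<close> weigh at most n^k together, and as
  \<open>n\<close> is at least 2 these powers sum to at most the next one.\<close>

lemma potential_bounded_degree:
  assumes "2 \<le> n" "F \<subseteq> {S. S \<subseteq> {..<n} \<and> card S \<le> d}"
  shows "potential F \<le> real n ^ Suc d"
proof -
  have "potential F \<le> (\<Sum>S | S \<subseteq> {..<n} \<and> card S \<le> d. weight (card S))"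
    unfolding potential_def using assms by (intro sum_mono2) auto
  also have "\<dots> = (\<Sum>k\<le>d. real (n choose k) * weight k)"
    by (subst sum_subsets_by_card) auto
  also have "\<dots> \<le> (\<Sum>k\<le>d. real n ^ k)"
  proof (intro sum_mono)
    fix k
    have "real (n choose k) * weight k \<le> real ((n choose k) * fact k)"
      using weight_le_fact[of k] by (simp add: mult_left_mono)
    also have "\<dots> \<le> real n ^ k"
      using binomial_fact_pow[of n k] by (metis of_nat_le_iff of_nat_power)
    finally show "real (n choose k) * weight k \<le> real n ^ k" .
  qed
  also have "\<dots> \<le> real n ^ Suc d"
  proof (induction d)
    case (Suc d)
    have "real n ^ Suc d + real n ^ Suc d \<le> real n * real n ^ Suc d"
      using assms(1) by (simp flip: mult_2 add: mult_right_mono)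
    with Suc show ?case by simp
  qed (use assms in simp)
  finally show ?thesis .
qed

text \<open>The maximal members carry a third of the potential and each of them is hit with probability
  1/2, in which case its weight is at least halved: this accounts for the loss of 1/12.\<close>

lemma expected_potential:
  fixes V :: "'a pmf" and Q :: "'a \<Rightarrow> nat set"
  assumes "finite F" "\<And>S. S \<in> F \<Longrightarrow> finite S"
    and hit: "\<And>M. M \<in> F \<Longrightarrow> \<forall>S\<in>F. \<not> M \<subset> S \<Longrightarrow> measure_pmf.prob V {t. Q t \<inter> M \<noteq> {}} \<ge> 1 / 2"
  shows "(\<integral>\<^sup>+ t. ennreal (\<Sum>S\<in>F. weight (card (S - Q t))) \<partial>measure_pmf V)
    \<le> ennreal (11 / 12 * potential F)"
proof -
  let ?X = "{M \<in> F. \<forall>S\<in>F. \<not> M \<subset> S}"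
  let ?I = "\<lambda>M. indicator {t. Q t \<inter> M \<noteq> {}} :: 'a \<Rightarrow> real"
  let ?g = "\<lambda>t. potential F - (\<Sum>M\<in>?X. weight (card M) / 2 * ?I M t)"
  have le: "(\<Sum>S\<in>F. weight (card (S - Q t))) \<le> ?g t" for t
  proof -
    have "(\<Sum>S\<in>F. weight (card (S - Q t))) \<le>
        (\<Sum>S\<in>F. weight (card S) - weight (card S) / 2 * of_bool (S \<inter> Q t \<noteq> {}))"
      by (intro sum_mono weight_card_Diff assms)
    also have "\<dots> = potential F - (\<Sum>S\<in>F. weight (card S) / 2 * ?I S t)"
      by (simp add: potential_def sum_subtractf indicator_def Int_commute)
    \<comment> \<open>The gain from members that are not maximal is dropped, as only maximal ones
      are known to be hit.\<close>
    also have "\<dots> \<le> ?g t"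
      using assms(1) by (intro diff_left_mono sum_mono2) auto
    finally show ?thesis .
  qed
  have int: "integrable (measure_pmf V) (?I M)" for M
    by (rule measure_pmf.integrable_const_bound[where B = 1]) auto
  have "0 \<le> ?g t" for t
    using le[of t] by (meson order_trans sum_nonneg weight_nonneg)
  then have "(\<integral>\<^sup>+ t. ennreal (?g t) \<partial>measure_pmf V) = ennreal (\<integral>t. ?g t \<partial>measure_pmf V)"
    using int by (intro nn_integral_eq_integral) auto
  also have "(\<integral>t. ?g t \<partial>measure_pmf V) =
      potential F - (\<Sum>M\<in>?X. weight (card M) / 2 * measure_pmf.prob V {t. Q t \<inter> M \<noteq> {}})"
    using int by (subst Bochner_Integration.integral_diff) (auto simp: Bochner_Integration.integral_sum)
  also have "\<dots> \<le> potential F - (\<Sum>M\<in>?X. weight (card M) / 2 * (1 / 2))"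
    using hit by (intro diff_left_mono sum_mono mult_left_mono) auto
  also have "\<dots> = potential F - potential ?X / 4"
    by (simp add: potential_def sum_divide_distrib)
  also have "\<dots> \<le> 11 / 12 * potential F"
    using potential_maximal[OF assms(1,2)] by simp
  finally have "(\<integral>\<^sup>+ t. ennreal (?g t) \<partial>measure_pmf V) \<le> ennreal (11 / 12 * potential F)"
    by (simp add: ennreal_leI)
  moreover have "(\<integral>\<^sup>+ t. ennreal (\<Sum>S\<in>F. weight (card (S - Q t))) \<partial>measure_pmf V)
      \<le> (\<integral>\<^sup>+ t. ennreal (?g t) \<partial>measure_pmf V)"
    by (intro nn_integral_mono ennreal_leI le)
  ultimately show ?thesis
    by (rule order_trans[rotated])
qed


subsection \<open>Verifiers\<close>

primrec queried :: "dtree \<Rightarrow> bool list \<Rightarrow> nat set" where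
  "queried (Answer b) Y = {}"
| "queried (Query i t u) Y = insert i (if Y ! i then queried u Y else queried t Y)"

lemma finite_queried: "finite (queried t Y)"
  by (induction t) auto

lemma card_queried_le: "card (queried t Y) \<le> queries t Y"
  by (induction t) (auto intro!: order_trans[OF card_insert_le_m1] simp: card_insert_if finite_queried)

lemma queried_valid: "valid_dtree n t \<Longrightarrow> queried t Y \<subseteq> {..<n}"
  by (induction t) auto

lemma result_cong: "(\<And>i. i \<in> queried t X \<Longrightarrow> Y ! i = X ! i) \<Longrightarrow> result t Y = result t X"
  by (induction t) (auto split: if_splits)

text \<open>A tree that reads no position on which \<open>X\<close> and \<open>Y\<close> differ when it is run on \<open>X\<close> cannot tell
  them apart, so a verifier must read such a position even without adapting to the answers.\<close>

lemma verifier_hits_block: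
  assumes V: "verifier n f X V" and Y: "Y \<in> cube n" "f Y \<noteq> f X"
    and M: "\<And>i. i < n \<Longrightarrow> i \<notin> M \<Longrightarrow> Y ! i = X ! i"
  shows "measure_pmf.prob V {t. queried t X \<inter> M \<noteq> {}} \<ge> 1 / 2"
proof -
  \<comment> \<open>Acceptance of \<open>X\<close> with probability 1 means that every tree in the
    support accepts \<open>X\<close>, so a tree rejecting \<open>Y\<close> must notice a
    difference.\<close>
  have "AE t in measure_pmf V. t \<in> {t. result t X}"
    using V measure_pmf.prob_eq_1[of "{t. result t X}" V] by (simp add: verifier_def)
  then have acc: "result t X" if "t \<in> set_pmf V" for t
    using that by (simp add: AE_measure_pmf_iff)
  have "t \<in> {t. queried t X \<inter> M \<noteq> {}}" if "t \<in> set_pmf V" "\<not> result t Y" for t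
  proof (rule ccontr)
    assume "t \<notin> {t. queried t X \<inter> M \<noteq> {}}"
    moreover have "queried t X \<subseteq> {..<n}"
      using V that(1) by (intro queried_valid) (auto simp: verifier_def randomized_algorithm_def)
    ultimately have "Y ! i = X ! i" if "i \<in> queried t X" for i
      using M[of i] that by auto
    then have "result t Y = result t X"
      by (rule result_cong)
    with that acc show False
      by simp
  qed
  then have "measure_pmf.prob V {t. \<not> result t Y} \<le> measure_pmf.prob V {t. queried t X \<inter> M \<noteq> {}}"
    by (intro measure_pmf.finite_measure_mono_AE) (auto simp: AE_measure_pmf_iff)
  moreover have "measure_pmf.prob V {t. \<not> result t Y} \<ge> 1 / 2"
    using V Y by (simp add: verifier_def)
  ultimately show ?thesis
    by linarith
qed

text \<open>With all positions as the block, a verifier makes at least one query on \<open>X\<close>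
  with probability 1/2. The bound later provides strict slack above \<open>RC\<close> and absorbs an
  additive 1.\<close>

lemma RC_ge_half:
  assumes "X \<in> cube n" "Y \<in> cube n" "f Y \<noteq> f X"
  shows "ennreal (1 / 2) \<le> RC n f"
proof -
  have "ennreal (1 / 2) \<le> worst_case_queries n V" if V: "verifier n f X V" for V
  proof -
    let ?H = "{t. queried t X \<inter> UNIV \<noteq> {}}"
    have "1 / 2 \<le> measure_pmf.prob V ?H"
      using verifier_hits_block[OF V assms(2,3), of UNIV] by simp
    then have "ennreal (1 / 2) \<le> emeasure (measure_pmf V) ?H"
      unfolding measure_pmf.emeasure_eq_measure by (rule ennreal_leI)
    also have "\<dots> = (\<integral>\<^sup>+ t. indicator ?H t \<partial>measure_pmf V)"
      by simp
    also have "\<dots> \<le> expected_queries V X"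
      unfolding expected_queries_def
    proof (intro nn_integral_mono)
      fix t
      show "indicator ?H t \<le> (of_nat (queries t X) :: ennreal)"
        by (cases t) (auto simp: indicator_def)
    qed
    also have "\<dots> \<le> worst_case_queries n V"
      unfolding worst_case_queries_def using assms(1) by (rule SUP_upper)
    finally show ?thesis .
  qed
  then have "ennreal (1 / 2) \<le> RC_at n f X"
    unfolding RC_at_def by (intro INF_greatest) auto
  also have "\<dots> \<le> RC n f"
    unfolding RC_def using assms(1) by (rule SUP_upper)
  finally show ?thesis .
qed

text \<open>The strict inequality turns the infimum in \<open>RC_at\<close> into an actual
  verifier.\<close>

lemma RC_less_verifier:
  assumes "X \<in> cube n" "RC n f < R"
  obtains V where "verifier n f X V" "worst_case_queries n V \<le> R"
proof -
  have "RC_at n f X \<le> RC n f"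
    unfolding RC_def using assms(1) by (rule SUP_upper)
  with assms(2) have "RC_at n f X < R"
    by simp
  then obtain V where "verifier n f X V" "worst_case_queries n V < R"
    unfolding RC_at_def INF_less_iff by auto
  then show ?thesis
    using that by simp
qed


subsection \<open>Zero-error algorithms on subcubes\<close>

definition agree :: "nat set \<Rightarrow> bool list \<Rightarrow> bool list \<Rightarrow> bool" where
  "agree K Y Z \<longleftrightarrow> (\<forall>i\<in>K. Y ! i = Z ! i)"

text \<open>The pair \<open>K\<close>, \<open>Z\<close> encodes a subcube: the bits in
  \<open>K\<close> are known to be those of \<open>Z\<close>. Nothing is asked of the algorithm
  outside it. Correctness on the whole support is correctness with probability 1.\<close>

definition solvable :: "nat \<Rightarrow> (bool list \<Rightarrow> bool) \<Rightarrow> nat set \<Rightarrow> bool list \<Rightarrow> ennreal \<Rightarrow> bool" where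
  "solvable n f K Z c \<longleftrightarrow> (\<exists>A. randomized_algorithm n A \<and>
     (\<forall>Y\<in>cube n. agree K Y Z \<longrightarrow>
        (\<forall>t\<in>set_pmf A. result t Y = f Y) \<and> expected_queries A Y \<le> c))"

lemma solvableE:
  assumes "solvable n f K Z c"
  obtains A where "randomized_algorithm n A"
    "\<And>Y t. Y \<in> cube n \<Longrightarrow> agree K Y Z \<Longrightarrow> t \<in> set_pmf A \<Longrightarrow> result t Y = f Y"
    "\<And>Y. Y \<in> cube n \<Longrightarrow> agree K Y Z \<Longrightarrow> expected_queries A Y \<le> c"
  using assms unfolding solvable_def by blast

lemma solvable_mono: "solvable n f K Z c \<Longrightarrow> c \<le> c' \<Longrightarrow> solvable n f K Z c'"
  unfolding solvable_def by (meson order_trans)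

lemma solvable_constant:
  assumes "\<And>Y. Y \<in> cube n \<Longrightarrow> agree K Y Z \<Longrightarrow> f Y = b"
  shows "solvable n f K Z c"
  unfolding solvable_def using assms
  by (intro exI[of _ "return_pmf (Answer b)"]) (auto simp: randomized_algorithm_def expected_queries_def)

text \<open>Draw \<open>v\<close> first, then run an algorithm for cost \<open>c v\<close>; the
  costs average.\<close>

lemma solvable_mix:
  assumes "\<And>v. v \<in> set_pmf V \<Longrightarrow> solvable n f K Z (c v)"
  shows "solvable n f K Z (\<integral>\<^sup>+ v. c v \<partial>measure_pmf V)"
proof -
  have "\<exists>A. v \<in> set_pmf V \<longrightarrow> randomized_algorithm n A \<and> (\<forall>Y\<in>cube n. agree K Y Z \<longrightarrow>
        (\<forall>t\<in>set_pmf A. result t Y = f Y) \<and> expected_queries A Y \<le> c v)" for v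
    using assms unfolding solvable_def by blast
  then obtain A where A: "\<And>v. v \<in> set_pmf V \<Longrightarrow> randomized_algorithm n (A v)"
      "\<And>v Y t. v \<in> set_pmf V \<Longrightarrow> Y \<in> cube n \<Longrightarrow> agree K Y Z \<Longrightarrow> t \<in> set_pmf (A v) \<Longrightarrow> result t Y = f Y"
      "\<And>v Y. v \<in> set_pmf V \<Longrightarrow> Y \<in> cube n \<Longrightarrow> agree K Y Z \<Longrightarrow> expected_queries (A v) Y \<le> c v"
    by metis
  have "expected_queries (bind_pmf V A) Y \<le> (\<integral>\<^sup>+ v. c v \<partial>measure_pmf V)"
    if "Y \<in> cube n" "agree K Y Z" for Y
    using A(3)[OF _ that] unfolding expected_queries_def
    by (auto intro!: nn_integral_mono_AE simp: AE_measure_pmf_iff)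
  then show ?thesis
    unfolding solvable_def using A(1,2)
    by (intro exI[of _ "bind_pmf V A"]) (auto simp: randomized_algorithm_def)
qed

lemma solvable_query:
  assumes i: "i < n" and Z: "Z \<in> cube n"
    and step: "\<And>Z'. Z' \<in> cube n \<Longrightarrow> agree K Z' Z \<Longrightarrow> solvable n f (insert i K) Z' c"
  shows "solvable n f K Z (1 + c)"
\<comment> \<open>A known bit is not queried again; the summand 1 is then slack.\<close>
proof (cases "i \<in> K")
  case True
  then have "solvable n f K Z c"
    using step[OF Z] by (simp add: agree_def insert_absorb)
  then show ?thesis
    by (rule solvable_mono) simp
next
  case False
  define Zb where "Zb b = Z[i := b]" for b
  have Zb: "Zb b \<in> cube n" "agree K (Zb b) Z" for b
    using Z False by (auto simp: cube_def agree_def Zb_def) (metis nth_list_update_neq)+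
  obtain A where A: "\<And>b. randomized_algorithm n (A b)"
    "\<And>b Y t. Y \<in> cube n \<Longrightarrow> agree (insert i K) Y (Zb b) \<Longrightarrow> t \<in> set_pmf (A b) \<Longrightarrow> result t Y = f Y"
    "\<And>b Y. Y \<in> cube n \<Longrightarrow> agree (insert i K) Y (Zb b) \<Longrightarrow> expected_queries (A b) Y \<le> c"
    using step[OF Zb] unfolding solvable_def by metis
  \<comment> \<open>Trees for both answers are drawn before the query, but only one of them is run
    and paid for.\<close>
  define B where "B = bind_pmf (A False) (\<lambda>t. map_pmf (Query i t) (A True))"
  have ag: "agree (insert i K) Y (Zb (Y ! i))" if "agree K Y Z" for Y
    using that i Z False by (auto simp: agree_def Zb_def cube_def nth_list_update)
  have "expected_queries B Y = 1 + expected_queries (A (Y ! i)) Y" for Y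
    by (cases "Y ! i") (simp_all add: expected_queries_def B_def nn_integral_add)
  moreover have "result t Y = f Y" if "Y \<in> cube n" "agree K Y Z" "t \<in> set_pmf B" for Y t
    using that(3) A(2)[OF that(1) ag[OF that(2)]] by (cases "Y ! i") (auto simp: B_def)
  moreover have "randomized_algorithm n B"
    using A(1) i by (auto simp: B_def randomized_algorithm_def)
  ultimately show ?thesis
    unfolding solvable_def using A(3) ag by (intro exI[of _ B]) (auto intro!: add_left_mono)
qed

section \<open>Restricted polynomials and query rounds\<close>

definition represents_on ::
    "nat \<Rightarrow> (bool list \<Rightarrow> bool) \<Rightarrow> nat set \<Rightarrow> bool list \<Rightarrow> (nat set \<Rightarrow> real) \<Rightarrow> bool" where
  "represents_on n f K Z p \<longleftrightarrow> p \<in> multilinear_polys n \<and> K \<subseteq> {..<n} \<and> (\<forall>S\<in>supp p. S \<inter> K = {}) \<and>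
     (\<forall>Y\<in>cube n. agree K Y Z \<longrightarrow> (poly_value n p (bits Y) \<noteq> 0 \<longleftrightarrow> f Y))"

lemma represents_on_fix_var:
  assumes "represents_on n f K Z p" "i < n" "agree K Z' Z"
  shows "represents_on n f (insert i K) Z' (fix_var i (Z' ! i) p)"
proof -
  have "agree K Y Z" "poly_value n (fix_var i (Z' ! i) p) (bits Y) = poly_value n p (bits Y)"
    if "agree (insert i K) Y Z'" for Y
    using that assms(2,3) by (auto simp: agree_def poly_value_fix_var)
  moreover have "S \<inter> insert i K = {}" if S: "S \<in> supp (fix_var i (Z' ! i) p)" for S
  proof -
    obtain S' where "S' \<in> supp p" "S = S' - {i}"
      using S supp_fix_var[of i "Z' ! i" p] by blast
    then show ?thesis
      using assms(1) by (auto simp: represents_on_def)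
  qed
  ultimately show ?thesis
    using assms(1,2) fix_var_multilinear[of p n i] by (simp add: represents_on_def)
qed

text \<open>Query \<open>Q\<close> bit by bit. Whatever the answers, the remaining monomials are old
  ones without \<open>Q\<close>, so one bound \<open>c\<close> serves all outcomes.\<close>

lemma solvable_query_set:
  assumes "finite Q" "Q \<subseteq> {..<n}" "Z \<in> cube n" "represents_on n f K Z p"
    and "\<And>K' Z' p'. Z' \<in> cube n \<Longrightarrow> represents_on n f K' Z' p' \<Longrightarrow>
      supp p' \<subseteq> (\<lambda>S. S - Q) ` supp p \<Longrightarrow> solvable n f K' Z' c"
  shows "solvable n f K Z (of_nat (card Q) + c)"
  using assms
proof (induction Q arbitrary: K Z p rule: finite_induct)
  case empty
  then show ?case
    by simp
next
  case (insert i Q)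
  have "solvable n f (insert i K) Z' (of_nat (card Q) + c)" if Z': "Z' \<in> cube n" "agree K Z' Z" for Z'
  proof (rule insert.IH)
    let ?p = "fix_var i (Z' ! i) p"
    show "represents_on n f (insert i K) Z' ?p"
      using insert.prems Z' by (intro represents_on_fix_var[of n f K Z]) auto
    fix K'' Z'' p'' assume *: "Z'' \<in> cube n" "represents_on n f K'' Z'' p''"
      and "supp p'' \<subseteq> (\<lambda>S. S - Q) ` supp ?p"
    note this(3)
    also have "(\<lambda>S. S - Q) ` supp ?p \<subseteq> (\<lambda>S. S - Q) ` (\<lambda>S. S - {i}) ` supp p"
      by (rule image_mono[OF supp_fix_var])
    also have "\<dots> = (\<lambda>S. S - insert i Q) ` supp p"
      by (simp add: image_image flip: Diff_insert2)
    finally show "solvable n f K'' Z'' c"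
      by (rule insert.prems(4)[OF *])
  qed (use insert.prems Z' in auto)
  then have "solvable n f K Z (1 + (of_nat (card Q) + c))"
    using insert.prems by (intro solvable_query[of i]) auto
  then show ?case
    using insert.hyps by (simp add: add.assoc)
qed

lemma solvable_constant_poly:
  assumes "represents_on n f K Z p" "supp p \<subseteq> {{}}"
  shows "solvable n f K Z c"
proof (rule solvable_constant)
  fix Y assume "Y \<in> cube n" "agree K Y Z"
  then show "f Y \<longleftrightarrow> p {} \<noteq> 0"
    using assms(1) poly_value_constant[OF assms(2)] by (auto simp: represents_on_def)
qed

text \<open>Changing only variables of \<open>M\<close> leads from the 0-input \<open>X\<close> to a
  point where \<open>p\<close> is nonzero, hence to a 1-input of the same subcube. The verifier must
  detect this block.\<close>

lemma verifier_hits_maximal_monomial: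
  assumes p: "represents_on n f K Z p" and X: "X \<in> cube n" "agree K X Z" "\<not> f X"
    and V: "verifier n f X V"
    and M: "M \<in> supp p" "\<forall>S\<in>supp p. \<not> M \<subset> S"
  shows "measure_pmf.prob V {t. queried t X \<inter> M \<noteq> {}} \<ge> 1 / 2"
proof -
  have M_sub: "M \<subseteq> {..<n}"
    using supp_multilinear[of p n] p M(1) by (auto simp: represents_on_def)
  have "p M \<noteq> 0" "\<And>S. M \<subset> S \<Longrightarrow> p S = 0"
    using M by (auto simp: supp_def)
  then obtain y where y: "\<forall>i. y i \<in> {0, 1}" "\<forall>i. i \<notin> M \<longrightarrow> y i = bits X i" "poly_value n p y \<noteq> 0"
    using maximal_monomial_nonvanishing[of M n p "bits X"] M_sub finite_subset[OF M_sub] by auto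
  define Y where "Y = map (\<lambda>i. y i = 1) [0..<n]"
  have Y: "Y \<in> cube n"
    by (simp add: Y_def cube_def)
  have out: "Y ! i = X ! i" if "i < n" "i \<notin> M" for i
    using that y(2) by (simp add: Y_def)
  \<comment> \<open>Monomials of the restricted polynomial avoid \<open>K\<close>, so the change on
    \<open>M\<close> stays inside the subcube.\<close>
  have "Y ! i = X ! i" if "i \<in> K" for i
    using p M(1) that by (intro out) (auto simp: represents_on_def)
  then have "agree K Y Z"
    using X(2) by (simp add: agree_def)
  moreover have "poly_value n p (bits Y) = poly_value n p y"
    using y(1) by (intro poly_value_cong) (auto simp: Y_def)
  ultimately have "f Y"
    using p Y y(3) by (auto simp: represents_on_def)
  with X(3) show ?thesis
    using verifier_hits_block[OF V Y _ out] by simp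
qed

text \<open>Induction on the number \<open>T\<close> of rounds left. Each costs at most
  \<open>R\<close> in expectation and shrinks the expected potential by 11/12; the last summand pays
  for querying all \<open>n\<close> bits if the polynomial is still not constant.\<close>

lemma solvable_rounds:
  assumes R: "RC n f < R" and "Z \<in> cube n" "represents_on n f K Z p"
  shows "solvable n f K Z (of_nat T * R + ennreal (real n * (11 / 12) ^ T * potential (supp p)))"
  using assms(2,3)
proof (induction T arbitrary: K Z p)
  case 0
  show ?case
  proof (cases "supp p \<subseteq> {{}}")
    case True
    with 0 show ?thesis by (intro solvable_constant_poly)
  next
    case False
    have p: "p \<in> multilinear_polys n"
      using 0 by (simp add: represents_on_def)
    have sub: "supp p \<subseteq> Pow {..<n}"
      using p by (rule supp_multilinear)
    have "1 \<le> potential (supp p)"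
      using finite_supp[OF p] False sub finite_subset[of _ "{..<n}"] by (intro potential_ge_1) auto
    then have "real n \<le> real n * potential (supp p)"
      by (simp add: mult_le_cancel_left1)
    then have "of_nat n \<le> ennreal (real n * potential (supp p))"
      by (metis ennreal_leI ennreal_of_nat_eq_real_of_nat)
    moreover have "solvable n f K Z (of_nat (card {..<n}) + 0)"
    proof (rule solvable_query_set[OF _ _ 0])
      fix K' Z' p' assume "represents_on n f K' Z' p'" "supp p' \<subseteq> (\<lambda>S. S - {..<n}) ` supp p"
      with sub show "solvable n f K' Z' 0"
        by (intro solvable_constant_poly) auto
    qed auto
    ultimately show ?thesis
      by (auto intro: solvable_mono)
  qed
next
  case (Suc T)
  let ?\<Phi> = "potential (supp p)"
  show ?case
  \<comment> \<open>Without a 0-input in the subcube there is no \<open>X\<close> to verify, but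
    then \<open>f\<close> is constant there.\<close>
  proof (cases "supp p \<subseteq> {{}} \<or> (\<forall>X\<in>cube n. agree K X Z \<longrightarrow> f X)")
    case True
    then show ?thesis
      using Suc.prems solvable_constant_poly solvable_constant[of n K Z f True] by blast
  next
    case False
    \<comment> \<open>\<open>X\<close> is only a reference point: the positions read on
      \<open>X\<close> are queried on the true input, whatever its bits are.\<close>
    then obtain X where X: "X \<in> cube n" "agree K X Z" "\<not> f X"
      by blast
    obtain V where V: "verifier n f X V" "worst_case_queries n V \<le> R"
      using RC_less_verifier[OF X(1) R] .
    have p: "p \<in> multilinear_polys n"
      using Suc.prems by (simp add: represents_on_def)
    have fin: "finite (supp p)" "\<And>S. S \<in> supp p \<Longrightarrow> finite S"
      using finite_supp[OF p] supp_multilinear[OF p] finite_subset[of _ "{..<n}"] by auto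
    define a where "a = real n * (11 / 12) ^ T"
    have a: "0 \<le> a"
      by (simp add: a_def)
    let ?w = "\<lambda>t. \<Sum>S\<in>supp p. weight (card (S - queried t X))"
    have w: "0 \<le> ?w t" for t
      by (simp add: sum_nonneg)
    let ?c = "\<lambda>t. of_nat (card (queried t X)) + (of_nat T * R + ennreal (a * ?w t))"
    have "solvable n f K Z (?c t)" if "t \<in> set_pmf V" for t
    proof (rule solvable_query_set[OF _ _ Suc.prems])
      show "queried t X \<subseteq> {..<n}"
        using V(1) that by (intro queried_valid) (auto simp: verifier_def randomized_algorithm_def)
      fix K' Z' p' assume *: "Z' \<in> cube n" "represents_on n f K' Z' p'"
        and "supp p' \<subseteq> (\<lambda>S. S - queried t X) ` supp p"
      then have "a * potential (supp p') \<le> a * ?w t"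
        using potential_image_Diff[OF fin(1)] a by (intro mult_left_mono) auto
      then show "solvable n f K' Z' (of_nat T * R + ennreal (a * ?w t))"
        using Suc.IH[OF *] by (auto simp: a_def intro: solvable_mono add_left_mono ennreal_leI)
    qed (rule finite_queried)
    then have mix: "solvable n f K Z (\<integral>\<^sup>+ t. ?c t \<partial>measure_pmf V)"
      by (rule solvable_mix)
    have "(\<integral>\<^sup>+ t. ?c t \<partial>measure_pmf V) =
        (\<integral>\<^sup>+ t. of_nat (card (queried t X)) \<partial>measure_pmf V) + (of_nat T * R +
        ennreal a * (\<integral>\<^sup>+ t. ennreal (?w t) \<partial>measure_pmf V))"
      by (simp add: nn_integral_add nn_integral_cmult ennreal_mult[OF a w])
    also have "\<dots> \<le> R + (of_nat T * R + ennreal a * ennreal (11 / 12 * ?\<Phi>))"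
    proof (intro add_mono mult_left_mono order_refl)
      have "(\<integral>\<^sup>+ t. of_nat (card (queried t X)) \<partial>measure_pmf V) \<le> expected_queries V X"
        unfolding expected_queries_def by (intro nn_integral_mono) (simp add: card_queried_le)
      also have "\<dots> \<le> worst_case_queries n V"
        unfolding worst_case_queries_def using X(1) by (rule SUP_upper)
      finally show "(\<integral>\<^sup>+ t. of_nat (card (queried t X)) \<partial>measure_pmf V) \<le> R"
        using V(2) by simp
      show "(\<integral>\<^sup>+ t. ennreal (?w t) \<partial>measure_pmf V) \<le> ennreal (11 / 12 * ?\<Phi>)"
        using verifier_hits_maximal_monomial[OF Suc.prems(2) X V(1)]
        by (intro expected_potential fin) auto
    qed simp_all
    also have "\<dots> = of_nat (Suc T) * R + ennreal (real n * (11 / 12) ^ Suc T * ?\<Phi>)"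
      using a potential_nonneg by (simp add: ennreal_mult[symmetric] a_def algebra_simps)
    finally show ?thesis
      by (rule solvable_mono[OF mix])
  qed
qed

section \<open>Number of rounds and the final bound\<close>

lemma R0_le_solvable:
  assumes "solvable n f {} Z c"
  shows "R0 n f \<le> c"
proof -
  obtain A where A: "randomized_algorithm n A"
    "\<And>Y t. Y \<in> cube n \<Longrightarrow> t \<in> set_pmf A \<Longrightarrow> result t Y = f Y"
    "\<And>Y. Y \<in> cube n \<Longrightarrow> expected_queries A Y \<le> c"
    using assms by (rule solvableE) (auto simp: agree_def)
  have "measure_pmf.prob A {t. result t Y = f Y} = 1" if "Y \<in> cube n" for Y
    using A(2)[OF that] by (subst measure_pmf.prob_eq_1) (auto simp: AE_measure_pmf_iff)
  then have "R0 n f \<le> worst_case_queries n A"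
    unfolding R0_def using A(1) by (intro INF_lower) (simp add: zero_error_def)
  also have "\<dots> \<le> c"
    unfolding worst_case_queries_def using A(3) by (rule SUP_least)
  finally show ?thesis .
qed

lemma number_of_rounds:
  assumes "2 \<le> n" "1 \<le> d"
  obtains T where "real n * (11 / 12) ^ T * real n ^ Suc d \<le> 1"
    "real T \<le> 37 * (real d * log 2 (real n))"
proof
  \<comment> \<open>The factor 12 matches the bound exp(-1/12) for 11/12. The exponent
    \<open>d + 2\<close> combines the initial potential n^(d+1) with the factor \<open>n\<close> for
    querying everything.\<close>
  define T where "T = nat \<lceil>12 * real (d + 2) * ln (real n)\<rceil>"
  have ln: "0 \<le> ln (real n)"
    using assms by simp
  have log: "ln (real n) \<le> log 2 (real n)" "1 \<le> log 2 (real n)"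
  proof -
    have "ln 2 \<le> (1::real)"
      using ln_le_minus_one[of "2::real"] by simp
    then show "ln (real n) \<le> log 2 (real n)"
      unfolding log_def using ln by (simp add: le_divide_eq mult_left_le)
    show "1 \<le> log 2 (real n)"
      using assms(1) by (simp add: le_log_iff)
  qed
  have T_ge: "12 * real (d + 2) * ln (real n) \<le> real T"
    unfolding T_def by linarith
  have "(11 / 12 :: real) \<le> exp (- (1 / 12))"
    using exp_ge_add_one_self[of "- (1 / 12) :: real"] by simp
  then have "(11 / 12 :: real) ^ T \<le> exp (- (1 / 12)) ^ T"
    by (intro power_mono) auto
  also have "\<dots> = exp (- (real T / 12))"
    by (simp flip: exp_of_nat_mult)
  also have "\<dots> \<le> exp (- (real (d + 2) * ln (real n)))"
    using T_ge by (simp add: algebra_simps)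
  also have "\<dots> = inverse (real n ^ (d + 2))"
    unfolding exp_minus exp_of_nat_mult using assms(1) by simp
  finally have "(11 / 12) ^ T * real n ^ (d + 2) \<le> 1"
    using assms(1) by (simp add: field_simps)
  then show "real n * (11 / 12) ^ T * real n ^ Suc d \<le> 1"
    by (simp add: algebra_simps)
  have "real T \<le> 12 * (real d + 2) * ln (real n) + 1"
  proof -
    have "0 \<le> 12 * real (d + 2) * ln (real n)"
      using ln by simp
    then have "real T \<le> 12 * real (d + 2) * ln (real n) + 1"
      unfolding T_def by linarith
    then show ?thesis
      by (simp add: add.commute)
  qed
  \<comment> \<open>As \<open>d\<close> is at least 1, \<open>d + 2\<close> is at most 3d, and the 1
    lost to rounding is at most d log n; hence 37 = 36 + 1.\<close>
  also have "\<dots> \<le> 12 * (3 * real d) * log 2 (real n) + real d * log 2 (real n)"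
    using assms(2) log ln by (intro add_mono mult_mono mult_ge1_I) auto
  finally show "real T \<le> 37 * (real d * log 2 (real n))"
    by (simp add: algebra_simps)
qed

theorem theorem10:
  "\<exists>c::real. c > 0 \<and>
     (\<forall>n\<ge>2. \<forall>f :: bool list \<Rightarrow> bool.
        R0 n f \<le> ennreal c * RC n f * of_nat (ndeg n f) * ennreal (log 2 (real n)))"
proof (intro exI[of _ "76::real"] conjI allI impI)
  fix n :: nat and f :: "bool list \<Rightarrow> bool"
  assume n: "2 \<le> n"
  define d where "d = ndeg n f"
  define Z where "Z = replicate n False"
  have Z: "Z \<in> cube n"
    by (simp add: Z_def cube_def)
  show "R0 n f \<le> ennreal 76 * RC n f * of_nat (ndeg n f) * ennreal (log 2 (real n))"
  proof (cases "\<forall>Y\<in>cube n. f Y = f Z")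
    case True
    then have "R0 n f \<le> 0"
      by (intro R0_le_solvable[of n f Z] solvable_constant) auto
    then show ?thesis by simp
  next
    case False
    then obtain Y where Y: "Y \<in> cube n" "f Y \<noteq> f Z"
      by blast
    obtain p where p: "p \<in> multilinear_polys n" "nondet_represents n p f" "poly_degree p = d"
      using ndeg_attained unfolding d_def .
    have sub: "supp p \<subseteq> {S. S \<subseteq> {..<n} \<and> card S \<le> d}"
      using supp_multilinear[OF p(1)] card_le_poly_degree[OF p(1)] p(3) by auto
    have "d \<noteq> 0"
    proof
      assume "d = 0"
      have "S = {}" if "S \<in> supp p" for S
        using that sub \<open>d = 0\<close> finite_subset[of S "{..<n}"] by auto
      then have "supp p \<subseteq> {{}}"
        by blast
      then have "f X \<longleftrightarrow> p {} \<noteq> 0" if "X \<in> cube n" for X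
        using p(2) that by (simp add: nondet_represents_def poly_value_constant)
      with Y Z show False
        by blast
    qed
    then have d: "1 \<le> d"
      by simp
    obtain T where T: "real n * (11 / 12) ^ T * real n ^ Suc d \<le> 1"
      "real T \<le> 37 * (real d * log 2 (real n))"
      using number_of_rounds[OF n d] .
    define L where "L = real d * log 2 (real n)"
    have "1 \<le> log 2 (real n)"
      using n by (simp add: le_log_iff)
    with d have L: "1 \<le> L"
      unfolding L_def by (intro mult_ge1_I) auto
    have RHS: "ennreal 76 * RC n f * of_nat d * ennreal (log 2 (real n)) = ennreal (76 * L) * RC n f"
      using n by (simp add: L_def ennreal_mult ennreal_of_nat_eq_real_of_nat algebra_simps)
    show ?thesis
    \<comment> \<open>An infinite \<open>RC\<close> makes the right side infinite, since
      \<open>L\<close> is positive. Otherwise the computation takes place in the reals.\<close>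
    proof (cases "RC n f = \<top>")
      case True
      then show ?thesis
        using L RHS by (simp add: d_def ennreal_mult_top)
    next
      case False
      then obtain r where r: "0 \<le> r" "RC n f = ennreal r"
        by (cases "RC n f") auto
      have half: "1 / 2 \<le> r"
        using RC_ge_half[OF Z Y] r by (simp only: ennreal_le_iff)
      then have "RC n f < ennreal (2 * r)"
        using r by (simp add: ennreal_less_iff)
      moreover have "represents_on n f {} Z p"
        using p by (auto simp: represents_on_def nondet_represents_def)
      ultimately have "R0 n f \<le> of_nat T * ennreal (2 * r) +
          ennreal (real n * (11 / 12) ^ T * potential (supp p))"
        using Z by (intro R0_le_solvable[of n f Z] solvable_rounds)
      also have "\<dots> = ennreal (real T * (2 * r) + real n * (11 / 12) ^ T * potential (supp p))"
        using r potential_nonneg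
        by (simp add: ennreal_mult ennreal_plus ennreal_of_nat_eq_real_of_nat)
      \<comment> \<open>The rounds contribute 2 * 37, where 2 is the slack above \<open>RC\<close>.
        The final term is at most 1, hence at most 2 * L * r; in total 76.\<close>
      also have "\<dots> \<le> ennreal (76 * L * r)"
      proof (rule ennreal_leI)
        have "real n * (11 / 12) ^ T * potential (supp p) \<le> real n * (11 / 12) ^ T * real n ^ Suc d"
          using potential_bounded_degree[OF n sub] by (intro mult_left_mono) auto
        also have "\<dots> \<le> 1"
          by (rule T(1))
        also have "1 \<le> L * (2 * r)"
          using L half by (simp add: mult_ge1_I)
        finally have "real n * (11 / 12) ^ T * potential (supp p) \<le> L * (2 * r)" .
        moreover have "real T * (2 * r) \<le> 37 * L * (2 * r)"
          using T(2) r by (intro mult_right_mono) (auto simp: L_def)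
        ultimately show "real T * (2 * r) + real n * (11 / 12) ^ T * potential (supp p) \<le> 76 * L * r"
          by (simp add: algebra_simps)
      qed
      also have "\<dots> = ennreal (76 * L) * RC n f"
        using L r by (simp add: ennreal_mult)
      finally show ?thesis
        using RHS by (simp add: d_def)
    qed
  qed
qed simp

end
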